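(* Let $\gamma^*\in(0,1]$ be the unique solution of $$\phi(\gamma)=\gamma e^{-1/\gamma}\sum_{j\in \mathcal S(\gamma)} \overline v_j-\sum_{j\in\mathcal J\setminus \mathcal S(\gamma)}\underline v_j\big(\gamma\ln(\underline v_j/\overline v_j)-\gamma+1\big)=0,\qquad \mathcal S(\gamma)=\{j\in\mathcal J:\underline v_j/\overline v_j<e^{-1/\gamma}\}.$$ Then $(M_{\gamma^*},\mathbb F_{\gamma^*})$ is a saddle point of $\sup_{M\in\mathcal M}\min_{\mathbb F\in\Delta(\mathcal V)}\mathcal R(M,\mathbb F)$, i.e. $$\mathcal R(M,\mathbb F_{\gamma^*})\le \mathcal R(M_{\gamma^*},\mathbb F_{\gamma^*})\le \mathcal R(M_{\gamma^*},\mathbb F)\quad\text{for all } M\in\mathcal M,\ \mathbb F\in\Delta(\mathcal V).$$ Consequently $M_{\gamma^*}$ is an optimal solution of $$\sup_{M\in\mathcal M}\ \inf_{\mathbb F\in\Delta(\mathcal V)}\frac{\mathrm{Rev}(M,\mathbb F)}{\sup_{M'\in\mathcal M}\mathrm{Rev}(M',\mathbb F)},$$ and it achieves the optimal performance ratio $\gamma^*$ (the optimal value of this problem).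
   Context: Setting. $\mathcal J=\{1,\dots,J\}$ is a finite set of products with bounds $0\le\underline v_j\le\overline v_j<\infty$, $\overline v_j>0$ for all $j$, and $\max_j\underline v_j>0$. $\mathcal V=\prod_{j\in\mathcal J}[\underline v_j,\overline v_j]$; $\boldsymbol 1$ is the all-ones vector; $\Delta(\mathcal V)$ is the set of Borel probability distributions on $\mathcal V$. A mechanism $M=(\boldsymbol q,t)$ consists of $\boldsymbol q:\mathcal V\to[0,1]^J$ and a (Borel measurable) $t:\mathcal V\to\mathbb R_+$. $\mathcal M$ is the set of mechanisms satisfying, for all $\boldsymbol v,\boldsymbol v'\in\mathcal V$, incentive compatibility (IC) $\boldsymbol q(\boldsymbol v)^\top\boldsymbol v-t(\boldsymbol v)\ge\boldsymbol q(\boldsymbol v')^\top\boldsymbol v-t(\boldsymbol v')$ and individual rationality (IR) $\boldsymbol q(\boldsymbol v)^\top\boldsymbol v-t(\boldsymbol v)\ge0$. For $M=(\boldsymbol q,t)$, $\mathrm{Rev}(M,\mathbb F)=\int_{\mathcal V} t\,d\mathbb F$ and $\mathcal R(M,\mathbb F)=\mathbb E_{\boldsymbol v\sim\mathbb F}[t(\boldsymbol v)/\boldsymbol 1^\top\boldsymbol v]$. Mechanism $M_\gamma$ ($\gamma\in(0,1]$): $\boldsymbol q(\boldsymbol v)=(q_1(v_1),\dots,q_J(v_J))$ with $q_j(v_j)=(\gamma\ln(v_j/\overline v_j)+1)^+$ (convention $\ln 0=-\infty$, $x^+=\max\{x,0\}$), and $t(\boldsymbol v)=\sum_j t_j(v_j)$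 with $t_j(v_j)=\gamma\,(v_j-e^{-1/\gamma}\overline v_j)^+$ if $e^{-1/\gamma}\overline v_j>\underline v_j$, and $t_j(v_j)=\gamma v_j+\underline v_j\big(\gamma(\ln(\underline v_j/\overline v_j)-1)+1\big)$ if $e^{-1/\gamma}\overline v_j\le\underline v_j$. Distribution $\mathbb F_\eta$ ($\eta\in(0,1]$): put $\omega_j=\overline v_je^{-1/\eta}$ if $\underline v_j/\overline v_j<e^{-1/\eta}$ and $\omega_j=\underline v_j$ otherwise; let $v_j(\xi)=\min\{\omega_j\xi,\overline v_j\}$ for $\xi\ge1$; let $\xi$ be a random variable on $[1,\infty)$ with cumulative distribution function $\mathbb G(\xi)=\zeta\int_1^\xi x^{-2}\sum_{j\in\mathcal J}v_j(x)\,dx$, where $\zeta>0$ is the normalizing constant making $\mathbb G$ a probability distribution. $\mathbb F_\eta$ is the law of $\boldsymbol v(\xi)=(v_1(\xi),\dots,v_J(\xi))$. *)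

theory Defs
  imports "HOL-Probability.Probability"
begin

text \<open>
  Products are indexed by a finite type \<open>'n\<close>; \<open>vl\<close> and \<open>vu\<close> are the vectors of lower and upper
  bounds, so that the set of valuations is \<open>cbox vl vu\<close>.  Mechanisms are pairs of total functions,
  but only their values on \<open>cbox vl vu\<close> are ever constrained or used.
\<close>

type_synonym 'n mechanism = "(real^'n \<Rightarrow> real^'n) \<times> (real^'n \<Rightarrow> real)"

definition val_space :: "real^'n \<Rightarrow> real^'n \<Rightarrow> (real^'n) measure" where
  "val_space vl vu = restrict_space borel (cbox vl vu)"

definition distributions :: "real^'n \<Rightarrow> real^'n \<Rightarrow> (real^'n) measure set" where
  "distributions vl vu = {F. prob_space F \<and> sets F = sets (val_space vl vu)}"

definition mechanisms :: "real^'n \<Rightarrow> real^'n \<Rightarrow> 'n mechanism set" where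
  "mechanisms vl vu = {(q, t).
     (\<forall>v \<in> cbox vl vu. \<forall>j. 0 \<le> q v $ j \<and> q v $ j \<le> 1) \<and>
     (\<forall>v \<in> cbox vl vu. 0 \<le> t v) \<and>
     t \<in> borel_measurable (val_space vl vu) \<and>
     (\<forall>v \<in> cbox vl vu. \<forall>v' \<in> cbox vl vu. q v \<bullet> v - t v \<ge> q v' \<bullet> v - t v') \<and>
     (\<forall>v \<in> cbox vl vu. q v \<bullet> v - t v \<ge> 0)}"

definition Rev :: "'n mechanism \<Rightarrow> (real^'n) measure \<Rightarrow> real" where
  "Rev M F = (\<integral>v. snd M v \<partial>F)"

definition rel_Rev :: "'n mechanism \<Rightarrow> (real^'n) measure \<Rightarrow> real" where
  "rel_Rev M F = (\<integral>v. snd M v / (\<Sum>j\<in>UNIV. v $ j) \<partial>F)"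

text \<open>The suprema and infima are taken in \<open>ereal\<close>, where they exist unconditionally.\<close>

definition performance_ratio :: "real^'n \<Rightarrow> real^'n \<Rightarrow> 'n mechanism \<Rightarrow> ereal" where
  "performance_ratio vl vu M =
     (INF F \<in> distributions vl vu.
        ereal (Rev M F) / (SUP M' \<in> mechanisms vl vu. ereal (Rev M' F)))"

definition saddle_point :: "'a set \<Rightarrow> 'b set \<Rightarrow> ('a \<Rightarrow> 'b \<Rightarrow> real) \<Rightarrow> 'a \<Rightarrow> 'b \<Rightarrow> bool" where
  "saddle_point A B R a b \<longleftrightarrow>
     a \<in> A \<and> b \<in> B \<and> (\<forall>x\<in>A. R x b \<le> R a b) \<and> (\<forall>y\<in>B. R a b \<le> R a y)"

text \<open>
  If \<open>vl $ j = 0\<close> then \<open>j \<in> low_set vl vu \<gamma>\<close>; hence the logarithms of \<open>vl $ j / vu $ j\<close> in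
  \<open>phi\<close> and \<open>opt_payment\<close> are only taken at positive arguments.
\<close>

definition low_set :: "real^'n \<Rightarrow> real^'n \<Rightarrow> real \<Rightarrow> 'n set" where
  "low_set vl vu \<gamma> = {j. vl $ j / vu $ j < exp (- 1 / \<gamma>)}"

definition phi :: "real^'n \<Rightarrow> real^'n \<Rightarrow> real \<Rightarrow> real" where
  "phi vl vu \<gamma> =
     \<gamma> * exp (- 1 / \<gamma>) * (\<Sum>j \<in> low_set vl vu \<gamma>. vu $ j)
     - (\<Sum>j \<in> UNIV - low_set vl vu \<gamma>. vl $ j * (\<gamma> * ln (vl $ j / vu $ j) - \<gamma> + 1))"

text \<open>
  The case distinction implements the convention that the logarithm of 0 is minus infinity
  (in the library \<open>ln 0 = 0\<close>).
\<close>

definition opt_alloc :: "real^'n \<Rightarrow> real \<Rightarrow> 'n \<Rightarrow> real \<Rightarrow> real" where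
  "opt_alloc vu \<gamma> j x = (if x = 0 then 0 else max (\<gamma> * ln (x / vu $ j) + 1) 0)"

definition opt_payment :: "real^'n \<Rightarrow> real^'n \<Rightarrow> real \<Rightarrow> 'n \<Rightarrow> real \<Rightarrow> real" where
  "opt_payment vl vu \<gamma> j x =
     (if exp (- 1 / \<gamma>) * vu $ j > vl $ j
      then \<gamma> * max (x - exp (- 1 / \<gamma>) * vu $ j) 0
      else \<gamma> * x + vl $ j * (\<gamma> * (ln (vl $ j / vu $ j) - 1) + 1))"

definition opt_mech :: "real^'n \<Rightarrow> real^'n \<Rightarrow> real \<Rightarrow> 'n mechanism" where
  "opt_mech vl vu \<gamma> =
     ((\<lambda>v. \<chi> j. opt_alloc vu \<gamma> j (v $ j)),
      (\<lambda>v. \<Sum>j\<in>UNIV. opt_payment vl vu \<gamma> j (v $ j)))"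

definition start_val :: "real^'n \<Rightarrow> real^'n \<Rightarrow> real \<Rightarrow> 'n \<Rightarrow> real" where
  "start_val vl vu \<eta> j =
     (if vl $ j / vu $ j < exp (- 1 / \<eta>) then vu $ j * exp (- 1 / \<eta>) else vl $ j)"

definition val_curve :: "real^'n \<Rightarrow> real^'n \<Rightarrow> real \<Rightarrow> real \<Rightarrow> real^'n" where
  "val_curve vl vu \<eta> \<xi> = (\<chi> j. min (start_val vl vu \<eta> j * \<xi>) (vu $ j))"

definition norm_const :: "real^'n \<Rightarrow> real^'n \<Rightarrow> real \<Rightarrow> real" where
  "norm_const vl vu \<eta> =
     inverse (LBINT x:{1..}. (\<Sum>j\<in>UNIV. val_curve vl vu \<eta> x $ j) / x\<^sup>2)"

definition xi_cdf :: "real^'n \<Rightarrow> real^'n \<Rightarrow> real \<Rightarrow> real \<Rightarrow> real" where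
  "xi_cdf vl vu \<eta> \<xi> =
     norm_const vl vu \<eta> * (LBINT x:{1..\<xi>}. (\<Sum>j\<in>UNIV. val_curve vl vu \<eta> x $ j) / x\<^sup>2)"

text \<open>
  \<open>xi_cdf\<close> vanishes on \<open>{..1}\<close>; the law is restricted to \<open>{1..}\<close> because \<open>val_curve\<close> may leave
  \<open>cbox vl vu\<close> to the left of 1.
\<close>

definition xi_law :: "real^'n \<Rightarrow> real^'n \<Rightarrow> real \<Rightarrow> real measure" where
  "xi_law vl vu \<eta> = restrict_space (interval_measure (xi_cdf vl vu \<eta>)) {1..}"

definition worst_dist :: "real^'n \<Rightarrow> real^'n \<Rightarrow> real \<Rightarrow> (real^'n) measure" where
  "worst_dist vl vu \<eta> = distr (xi_law vl vu \<eta>) (val_space vl vu) (val_curve vl vu \<eta>)"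

end

theory Submission
  imports Defs "HOL-Real_Asymp.Real_Asymp"
begin

text \<open>
  Both halves of the saddle point come down to a pointwise inequality.  The payments of the optimal
  mechanism satisfy \<open>t v \<ge> \<gamma> (\<Sum>j. v $ j) - phi \<gamma>\<close> on the whole box, which at the root of \<open>phi\<close> bounds
  its relative revenue below by \<open>\<gamma>\<close> under every distribution.  Under the worst distribution the
  relative revenue of an arbitrary mechanism is a multiple of the integral of \<open>t (v \<xi>) / \<xi>\<^sup>2\<close>, and
  incentive compatibility along the curve \<open>v \<xi>\<close> bounds this integral by the sum of the starting
  values of the curve; at the root of \<open>phi\<close> the multiple of that sum is exactly \<open>\<gamma>\<close>.  The performance
  ratio is controlled by point masses, whose optimal revenue (posting the price of the bundle) is
  the full surplus, so that it is at most \<open>t v / (\<Sum>j. v $ j)\<close> for every \<open>v\<close> and hence at most the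
  mean of this quotient under the worst distribution.
\<close>

section \<open>Point masses as test distributions\<close>

lemma performance_ratio_le_point:
  fixes vl vu :: "real^'n"
  assumes v: "v \<in> cbox vl vu" and pos: "0 < (\<Sum>j\<in>UNIV. v $ j)"
    and nonneg: "\<And>j. 0 \<le> vl $ j"
    and M: "M \<in> mechanisms vl vu"
  shows "performance_ratio vl vu M \<le> ereal (snd M v / (\<Sum>j\<in>UNIV. v $ j))"
proof -
  define p where "p = (\<Sum>j\<in>UNIV. v $ j)"
  define F where "F = return (val_space vl vu) v"
  \<comment> \<open>\<open>B\<close> posts the price \<open>p\<close> for the bundle of all
    products. Whether a type buys depends only on its total value, so the mechanism is truthful, and
    \<open>p\<close> is chosen so that type \<open>v\<close> pays its whole surplus.\<close>
  define B :: "'n mechanism" where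
    "B = ((\<lambda>x. if p \<le> (\<Sum>j\<in>UNIV. x $ j) then 1 else 0),
          (\<lambda>x. if p \<le> (\<Sum>j\<in>UNIV. x $ j) then p else 0))"
  have v': "v \<in> space (val_space vl vu)"
    using v by (simp add: val_space_def)
  have F: "F \<in> distributions vl vu"
    unfolding distributions_def F_def using prob_space_return[OF v'] by simp
  have Rev_F: "Rev M' F = snd M' v" if "M' \<in> mechanisms vl vu" for M'
    using that v' unfolding Rev_def F_def
    by (subst integral_return) (auto simp: mechanisms_def)
  have "(\<lambda>x::real^'n. if p \<le> (\<Sum>j\<in>UNIV. x $ j) then p else 0) \<in> borel_measurable borel"
    by measurable
  then have "(\<lambda>x::real^'n. if p \<le> (\<Sum>j\<in>UNIV. x $ j) then p else 0)
      \<in> borel_measurable (val_space vl vu)"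
    unfolding val_space_def by (rule measurable_restrict_space1)
  then have B: "B \<in> mechanisms vl vu"
    using pos by (auto simp: mechanisms_def B_def inner_vec_def p_def)
  have "ereal p = ereal (Rev B F)"
    using Rev_F[OF B] by (simp add: B_def p_def)
  also have "\<dots> \<le> (SUP M' \<in> mechanisms vl vu. ereal (Rev M' F))"
    using B by (rule SUP_upper)
  finally have lower: "ereal p \<le> (SUP M' \<in> mechanisms vl vu. ereal (Rev M' F))" .
  have t0: "0 \<le> snd M v"
    using M v by (auto simp: mechanisms_def)
  have "performance_ratio vl vu M \<le>
      ereal (Rev M F) / (SUP M' \<in> mechanisms vl vu. ereal (Rev M' F))"
    unfolding performance_ratio_def using F by (rule INF_lower)
  \<comment> \<open>The supremum is not known to be finite here. If it is infinite, the quotient is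
    0 and the bound follows from \<open>t0\<close>.\<close>
  also have "\<dots> \<le> ereal (snd M v) / ereal p"
    unfolding Rev_F[OF M] using lower t0 pos
    by (cases "SUP M' \<in> mechanisms vl vu. ereal (Rev M' F)")
      (auto simp: p_def intro: divide_left_mono)
  also have "\<dots> = ereal (snd M v / p)"
    using pos by (simp add: p_def)
  finally show ?thesis
    by (simp add: p_def)
qed

section \<open>Basic estimates for mechanisms and distributions on the box\<close>

locale valuation_bounds =
  fixes vl vu :: "real^'n"
  assumes vl_nonneg: "\<And>j. 0 \<le> vl $ j"
    and vl_le_vu: "\<And>j. vl $ j \<le> vu $ j"
    and vu_pos: "\<And>j. 0 < vu $ j"
    and Max_vl_pos: "Max (range (\<lambda>j. vl $ j)) > 0"
begin

text \<open>A positive maximum means that some lower bound is positive. This keeps the total value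
  away from 0 on the whole box, so relative revenue never divides by 0.\<close>

lemma sum_vl_pos: "0 < (\<Sum>j\<in>UNIV. vl $ j)"
proof -
  have "Max (range (\<lambda>j. vl $ j)) \<in> range (\<lambda>j. vl $ j)"
    by (rule Max_in) auto
  then obtain j where "0 < vl $ j"
    using Max_vl_pos by (metis rangeE)
  then show ?thesis
    using vl_nonneg by (intro sum_pos2[of _ j]) auto
qed

lemma sum_valuation_pos:
  assumes "v \<in> cbox vl vu"
  shows "0 < (\<Sum>j\<in>UNIV. v $ j)"
proof -
  have "(\<Sum>j\<in>UNIV. vl $ j) \<le> (\<Sum>j\<in>UNIV. v $ j)"
    using assms by (intro sum_mono) (auto simp: mem_box_cart)
  then show ?thesis
    using sum_vl_pos by simp
qed

lemma mechanismD:
  assumes "M \<in> mechanisms vl vu" "v \<in> cbox vl vu"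
  shows "0 \<le> fst M v $ j" "fst M v $ j \<le> 1" "0 \<le> snd M v"
    "snd M v \<le> fst M v \<bullet> v" "snd M v \<le> (\<Sum>j\<in>UNIV. v $ j)"
    "v' \<in> cbox vl vu \<Longrightarrow> fst M v' \<bullet> v - snd M v' \<le> fst M v \<bullet> v - snd M v"
proof -
  obtain q t where M: "M = (q, t)"
    by (cases M)
  show "0 \<le> fst M v $ j" "fst M v $ j \<le> 1" "0 \<le> snd M v"
    "v' \<in> cbox vl vu \<Longrightarrow> fst M v' \<bullet> v - snd M v' \<le> fst M v \<bullet> v - snd M v"
    using assms by (auto simp: mechanisms_def M)
  show IR: "snd M v \<le> fst M v \<bullet> v"
    using assms by (auto simp: mechanisms_def M)
  have "fst M v \<bullet> v \<le> (\<Sum>j\<in>UNIV. v $ j)"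
    unfolding inner_vec_def inner_real_def
  proof (intro sum_mono)
    fix i
    have "0 \<le> v $ i" "fst M v $ i \<le> 1"
      using assms vl_nonneg[of i] by (auto simp: mem_box_cart mechanisms_def M intro: order_trans)
    then show "fst M v $ i * v $ i \<le> v $ i"
      using mult_right_mono[of "fst M v $ i" 1 "v $ i"] by simp
  qed
  then show "snd M v \<le> (\<Sum>j\<in>UNIV. v $ j)"
    using IR by simp
qed

lemma measurable_payment:
  "M \<in> mechanisms vl vu \<Longrightarrow> snd M \<in> borel_measurable (val_space vl vu)"
  by (auto simp: mechanisms_def)

lemma measurable_val_space_borel:
  "f \<in> borel_measurable borel \<Longrightarrow> f \<in> borel_measurable (val_space vl vu)"
  unfolding val_space_def by (rule measurable_restrict_space1)

lemma distributionsD: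
  assumes "F \<in> distributions vl vu"
  shows "prob_space F" "space F = cbox vl vu"
    "f \<in> borel_measurable (val_space vl vu) \<Longrightarrow> f \<in> borel_measurable F"
proof -
  have s: "sets F = sets (val_space vl vu)"
    using assms by (simp add: distributions_def)
  show "prob_space F"
    using assms by (simp add: distributions_def)
  show "space F = cbox vl vu"
    using sets_eq_imp_space_eq[OF s] by (simp add: val_space_def)
  show "f \<in> borel_measurable (val_space vl vu) \<Longrightarrow> f \<in> borel_measurable F"
    using measurable_cong_sets[OF s refl] by blast
qed

text \<open>The integral of a non-integrable function defaults to 0, so integrability has to be
  secured before integrals are compared. The quotient lies between 0 and 1 because the payment never
  exceeds the total value.\<close>

lemma integrable_rel_payment:
  assumes M: "M \<in> mechanisms vl vu" and F: "F \<in> distributions vl vu"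
  shows "integrable F (\<lambda>v. snd M v / (\<Sum>j\<in>UNIV. v $ j))"
proof -
  interpret prob_space F
    using F by (rule distributionsD)
  have "(\<lambda>v. snd M v / (\<Sum>j\<in>UNIV. v $ j)) \<in> borel_measurable F"
    by (intro distributionsD(3)[OF F] borel_measurable_divide measurable_payment[OF M]
        measurable_val_space_borel) measurable
  then show ?thesis
    by (intro integrable_const_bound[of _ 1] AE_I2)
      (auto simp: distributionsD(2)[OF F] divide_le_eq abs_of_nonneg mechanismD[OF M] sum_valuation_pos
        less_imp_le)
qed

lemma integrable_payment_and_sum:
  assumes M: "M \<in> mechanisms vl vu" and F: "F \<in> distributions vl vu"
  shows "integrable F (snd M)" "integrable F (\<lambda>v. \<Sum>j\<in>UNIV. v $ j)"
proof -
  interpret prob_space F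
    using F by (rule distributionsD)
  have bound: "(\<Sum>j\<in>UNIV. v $ j) \<le> (\<Sum>j\<in>UNIV. vu $ j)" if "v \<in> cbox vl vu" for v
    using that by (intro sum_mono) (auto simp: mem_box_cart)
  have "(\<lambda>v. \<Sum>j\<in>UNIV. v $ j) \<in> borel_measurable F"
    by (intro distributionsD(3)[OF F] measurable_val_space_borel) measurable
  then show "integrable F (\<lambda>v. \<Sum>j\<in>UNIV. v $ j)"
    by (intro integrable_const_bound[of _ "\<Sum>j\<in>UNIV. vu $ j"] AE_I2)
      (auto simp: distributionsD(2)[OF F] abs_of_pos sum_valuation_pos bound)
  show "integrable F (snd M)"
    using distributionsD(3)[OF F measurable_payment[OF M]]
    by (intro integrable_const_bound[of _ "\<Sum>j\<in>UNIV. vu $ j"] AE_I2)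
      (auto simp: distributionsD(2)[OF F] abs_of_nonneg mechanismD[OF M]
        intro: order_trans[OF mechanismD(5)[OF M] bound])
qed

section \<open>Bounds for relative revenue and performance ratio\<close>

lemma rel_Rev_ge:
  assumes M: "M \<in> mechanisms vl vu" and F: "F \<in> distributions vl vu"
    and ge: "\<And>v. v \<in> cbox vl vu \<Longrightarrow> c * (\<Sum>j\<in>UNIV. v $ j) \<le> snd M v"
  shows "c \<le> rel_Rev M F"
proof -
  interpret prob_space F
    using F by (rule distributionsD)
  show ?thesis
    unfolding rel_Rev_def using integrable_rel_payment[OF M F]
    by (intro integral_ge_const AE_I2)
      (auto simp: distributionsD(2)[OF F] le_divide_eq sum_valuation_pos ge)
qed

text \<open>No mechanism earns more than the expected surplus \<open>W\<close>, while the pointwise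
  bound guarantees that \<open>M\<close> earns at least \<open>c * W\<close>.\<close>

lemma performance_ratio_ge:
  assumes M: "M \<in> mechanisms vl vu" and c: "0 < c"
    and ge: "\<And>v. v \<in> cbox vl vu \<Longrightarrow> c * (\<Sum>j\<in>UNIV. v $ j) \<le> snd M v"
  shows "ereal c \<le> performance_ratio vl vu M"
  unfolding performance_ratio_def
proof (rule INF_greatest)
  fix F assume F: "F \<in> distributions vl vu"
  interpret prob_space F
    using F by (rule distributionsD)
  define W where "W = (\<integral>v. (\<Sum>j\<in>UNIV. v $ j) \<partial>F)"
  define S where "S = (SUP M' \<in> mechanisms vl vu. ereal (Rev M' F))"
  have W0: "0 < W"
  proof -
    have "(\<Sum>j\<in>UNIV. vl $ j) \<le> W"
      unfolding W_def using integrable_payment_and_sum(2)[OF M F]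
      by (intro integral_ge_const AE_I2 sum_mono) (auto simp: distributionsD(2)[OF F] mem_box_cart)
    then show ?thesis
      using sum_vl_pos by simp
  qed
  have lower: "c * W \<le> Rev M F"
    unfolding W_def Rev_def using integrable_payment_and_sum[OF M F]
    by (subst integral_mult_right_zero[symmetric], intro integral_mono)
      (auto simp: distributionsD(2)[OF F] ge)
  have "S \<le> ereal W"
    unfolding S_def
  proof (rule SUP_least)
    fix M' assume M': "M' \<in> mechanisms vl vu"
    show "ereal (Rev M' F) \<le> ereal W"
      unfolding W_def Rev_def using integrable_payment_and_sum[OF M' F]
      by (auto simp: distributionsD(2)[OF F] mechanismD[OF M'] intro!: integral_mono)
  qed
  moreover have "ereal (Rev M F) \<le> S"
    unfolding S_def using M by (rule SUP_upper)
  \<comment> \<open>The supremum is squeezed between \<open>Rev M F\<close> and \<open>W\<close>,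
    hence real. It is also positive since \<open>c * W\<close> is, so the division in
    \<open>ereal\<close> becomes an ordinary one.\<close>
  ultimately obtain s where s: "S = ereal s" "s \<le> W" "Rev M F \<le> s"
    by (cases S) auto
  have "0 < c * W"
    using c W0 by simp
  with lower s have "0 < s"
    by simp
  have "c * s \<le> c * W"
    using c s by simp
  with lower have "c * s \<le> Rev M F"
    by simp
  then have "c \<le> Rev M F / s"
    using \<open>0 < s\<close> by (simp add: le_divide_eq)
  then show "ereal c \<le> ereal (Rev M F) / (SUP M' \<in> mechanisms vl vu. ereal (Rev M' F))"
    using \<open>0 < s\<close> unfolding S_def[symmetric] s(1) by simp
qed

text \<open>Every real number below the ratio satisfies the point mass bound at each
  \<open>v\<close>, and averaging over \<open>F\<close> preserves it. Approaching the ratio from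
  below avoids knowing beforehand that it is finite.\<close>

lemma performance_ratio_le_rel_Rev:
  assumes M: "M \<in> mechanisms vl vu" and F: "F \<in> distributions vl vu"
  shows "performance_ratio vl vu M \<le> ereal (rel_Rev M F)"
proof (rule dense_le)
  fix z assume z: "z < performance_ratio vl vu M"
  show "z \<le> ereal (rel_Rev M F)"
  proof (cases z)
    case (real c)
    have "c * (\<Sum>j\<in>UNIV. v $ j) \<le> snd M v" if v: "v \<in> cbox vl vu" for v
    proof -
      have "ereal c \<le> ereal (snd M v / (\<Sum>j\<in>UNIV. v $ j))"
        using z performance_ratio_le_point[OF v sum_valuation_pos[OF v] vl_nonneg M] real
        by (metis less_imp_le order_trans)
      then show ?thesis
        using sum_valuation_pos[OF v] by (simp add: le_divide_eq)
    qed
    then show ?thesis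
      using rel_Rev_ge[OF M F] real by simp
  qed (use z in auto)
qed

section \<open>Starting values and the root of \<open>phi\<close>\<close>

abbreviation w :: "real \<Rightarrow> 'n \<Rightarrow> real" where
  "w \<equiv> start_val vl vu"

text \<open>The two cases of \<open>start_val\<close> meet at the threshold. Positivity, the bounds
  and the continuity in \<gamma> are read off from the maximum.\<close>

lemma start_val_eq_max: "w \<gamma> j = max (vl $ j) (vu $ j * exp (- 1 / \<gamma>))"
  using vu_pos[of j] by (auto simp: start_val_def divide_less_eq mult.commute)

lemma start_val_pos: "0 < w \<gamma> j"
  using vu_pos[of j] by (simp add: start_val_eq_max less_max_iff_disj)

lemma start_val_ge: "vl $ j \<le> w \<gamma> j"
  by (simp add: start_val_eq_max)

lemma start_val_le: "0 < \<gamma> \<Longrightarrow> w \<gamma> j \<le> vu $ j"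
  using vu_pos[of j] vl_le_vu[of j] by (auto simp: start_val_eq_max mult_le_cancel_left2)

text \<open>\<open>\<gamma> * ln (w \<gamma> j / vu $ j) + 1\<close> is the allocation at the
  starting value. The two parts act as complementary slackness: multiplied by
  \<open>x - w \<gamma> j\<close> with \<open>vl $ j \<le> x\<close>, this allocation gives a
  nonnegative number.\<close>

lemma start_val_alloc:
  assumes "0 < \<gamma>"
  shows "0 \<le> \<gamma> * ln (w \<gamma> j / vu $ j) + 1"
    "w \<gamma> j \<noteq> vl $ j \<Longrightarrow> \<gamma> * ln (w \<gamma> j / vu $ j) + 1 = 0"
proof -
  have "exp (- 1 / \<gamma>) \<le> w \<gamma> j / vu $ j"
    using vu_pos[of j] by (simp add: start_val_eq_max le_divide_eq mult.commute)
  then have "- 1 / \<gamma> \<le> ln (w \<gamma> j / vu $ j)"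
    using start_val_pos vu_pos by (simp add: ln_ge_iff)
  then show "0 \<le> \<gamma> * ln (w \<gamma> j / vu $ j) + 1"
    using assms by (simp add: field_simps)
  show "\<gamma> * ln (w \<gamma> j / vu $ j) + 1 = 0" if "w \<gamma> j \<noteq> vl $ j"
    using that assms vu_pos[of j] by (auto simp: start_val_def split: if_splits)
qed

text \<open>One formula for both sums in \<open>phi\<close>: on \<open>low_set\<close> the logarithm
  is \<open>- 1 / \<gamma>\<close> and the bracket collapses to \<gamma>. It also equals \<gamma>
  times the starting value minus the starting value times its allocation.\<close>

definition phi_term :: "real \<Rightarrow> 'n \<Rightarrow> real" where
  "phi_term \<gamma> j = w \<gamma> j * (\<gamma> - 1 - \<gamma> * ln (w \<gamma> j / vu $ j))"

lemma phi_eq_sum: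
  assumes "0 < \<gamma>"
  shows "phi vl vu \<gamma> = (\<Sum>j\<in>UNIV. phi_term \<gamma> j)"
proof -
  let ?S = "low_set vl vu \<gamma>"
  have low: "phi_term \<gamma> j = \<gamma> * exp (- 1 / \<gamma>) * vu $ j" if "j \<in> ?S" for j
    using that assms vu_pos[of j] by (simp add: low_set_def phi_term_def start_val_def)
  have high: "phi_term \<gamma> j = - (vl $ j * (\<gamma> * ln (vl $ j / vu $ j) - \<gamma> + 1))"
    if "j \<in> UNIV - ?S" for j
    using that by (simp add: low_set_def phi_term_def start_val_def algebra_simps)
  have "(\<Sum>j\<in>UNIV. phi_term \<gamma> j) = (\<Sum>j\<in>UNIV - ?S. phi_term \<gamma> j) + (\<Sum>j\<in>?S. phi_term \<gamma> j)"
    by (rule sum.subset_diff) auto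
  also have "(\<Sum>j\<in>?S. phi_term \<gamma> j) = \<gamma> * exp (- 1 / \<gamma>) * (\<Sum>j\<in>?S. vu $ j)"
    unfolding sum_distrib_left by (intro sum.cong refl low)
  also have "(\<Sum>j\<in>UNIV - ?S. phi_term \<gamma> j) =
      - (\<Sum>j\<in>UNIV - ?S. vl $ j * (\<gamma> * ln (vl $ j / vu $ j) - \<gamma> + 1))"
    unfolding sum_negf[symmetric] by (intro sum.cong refl high)
  finally show ?thesis
    unfolding phi_def by simp
qed

text \<open>
  \<open>phi_term \<gamma> j\<close> is the maximum over \<open>x\<close> of the expressions on the left, each of which increases
  strictly in \<open>\<gamma>\<close>.
\<close>

lemma phi_term_ge:
  assumes "0 < \<gamma>" "vl $ j \<le> x" "0 < x"
  shows "x * (\<gamma> - 1 - \<gamma> * ln (x / vu $ j)) \<le> phi_term \<gamma> j"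
proof -
  let ?L = "ln (w \<gamma> j / vu $ j)"
  have ln_x: "ln (x / vu $ j) = ?L - ln (w \<gamma> j / x)"
    using assms start_val_pos[of \<gamma> j] vu_pos[of j] by (simp add: ln_div)
  have "x * ln (w \<gamma> j / x) \<le> x * (w \<gamma> j / x - 1)"
    using assms start_val_pos[of \<gamma> j] by (intro mult_left_mono ln_le_minus_one) auto
  also have "\<dots> = w \<gamma> j - x"
    using assms by (simp add: field_simps)
  finally have "\<gamma> * (x * ln (w \<gamma> j / x)) \<le> \<gamma> * (w \<gamma> j - x)"
    using assms by simp
  moreover have "0 \<le> (x - w \<gamma> j) * (\<gamma> * ?L + 1)"
  proof (cases "w \<gamma> j = vl $ j")
    case True
    then show ?thesis
      using assms start_val_alloc(1)[of \<gamma> j] by simp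
  qed (simp add: start_val_alloc(2) assms)
  ultimately show ?thesis
    unfolding phi_term_def ln_x by (simp add: algebra_simps)
qed

lemma phi_strict_mono:
  assumes "0 < \<gamma>" "\<gamma> < \<gamma>'"
  shows "phi vl vu \<gamma> < phi vl vu \<gamma>'"
proof -
  have "phi_term \<gamma> j < phi_term \<gamma>' j" for j
  proof -
    let ?w = "w \<gamma> j" and ?L = "ln (w \<gamma> j / vu $ j)"
    have "?L \<le> 0"
      using start_val_pos[of \<gamma> j] start_val_le[OF assms(1), of j] vu_pos[of j] by simp
    then have "\<gamma> * (1 - ?L) < \<gamma>' * (1 - ?L)"
      using assms by (intro mult_strict_right_mono) auto
    then have "?w * (\<gamma> - 1 - \<gamma> * ?L) < ?w * (\<gamma>' - 1 - \<gamma>' * ?L)"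
      using start_val_pos[of \<gamma> j] by (intro mult_strict_left_mono) (auto simp: algebra_simps)
    \<comment> \<open>The maximizer for \<gamma> remains a candidate for \<gamma>', because the
      constraint \<open>vl $ j \<le> x\<close> does not involve \<gamma>.\<close>
    also have "\<dots> \<le> phi_term \<gamma>' j"
      using assms start_val_pos start_val_ge by (intro phi_term_ge) auto
    finally show ?thesis
      by (simp add: phi_term_def)
  qed
  then show ?thesis
    using assms by (simp add: phi_eq_sum sum_strict_mono)
qed

text \<open>The index set \<open>low_set\<close> jumps as \<gamma> varies, but in the form given by
  \<open>phi_eq_sum\<close> the parameter enters only continuously.\<close>

lemma continuous_on_phi: "continuous_on {0<..} (phi vl vu)"
proof -
  have "continuous_on {0<..} (\<lambda>\<gamma>. phi_term \<gamma> j)" for j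
  proof -
    have w: "continuous_on {0<..} (\<lambda>\<gamma>. w \<gamma> j)"
      unfolding start_val_eq_max by (intro continuous_intros) auto
    show ?thesis
      unfolding phi_term_def using start_val_pos[of _ j] vu_pos[of j]
      by (intro continuous_intros w) (auto simp: less_le)
  qed
  then have "continuous_on {0<..} (\<lambda>\<gamma>. \<Sum>j\<in>UNIV. phi_term \<gamma> j)"
    by (intro continuous_intros)
  then show ?thesis
    using phi_eq_sum by (subst continuous_on_cong[OF refl]) auto
qed

text \<open>Supplies the left endpoint for the intermediate value theorem: the right side vanishes
  when \<gamma> is the quotient of the two sums of bounds. The estimate comes from
  \<open>ln y \<le> y - 1\<close> at \<open>y = vu $ j / w \<gamma> j\<close>.\<close>

lemma phi_le_linear:
  assumes "0 < \<gamma>"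
  shows "phi vl vu \<gamma> \<le> \<gamma> * (\<Sum>j\<in>UNIV. vu $ j) - (\<Sum>j\<in>UNIV. vl $ j)"
proof -
  have "phi_term \<gamma> j \<le> \<gamma> * vu $ j - vl $ j" for j
  proof -
    have "ln (vu $ j / w \<gamma> j) \<le> vu $ j / w \<gamma> j - 1"
      using start_val_pos vu_pos by (intro ln_le_minus_one) simp
    then have "w \<gamma> j * ln (vu $ j / w \<gamma> j) \<le> w \<gamma> j * (vu $ j / w \<gamma> j - 1)"
      using start_val_pos by (intro mult_left_mono) (auto intro: less_imp_le)
    also have "\<dots> = vu $ j - w \<gamma> j"
      using start_val_pos[of \<gamma> j] by (simp add: field_simps)
    finally have "\<gamma> * (w \<gamma> j * ln (vu $ j / w \<gamma> j)) \<le> \<gamma> * (vu $ j - w \<gamma> j)"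
      using assms by simp
    moreover have "ln (w \<gamma> j / vu $ j) = - ln (vu $ j / w \<gamma> j)"
      using start_val_pos[of \<gamma> j] vu_pos[of j] by (simp add: ln_div)
    ultimately show ?thesis
      using start_val_ge[of j \<gamma>] by (simp add: phi_term_def algebra_simps)
  qed
  then have "(\<Sum>j\<in>UNIV. phi_term \<gamma> j) \<le> (\<Sum>j\<in>UNIV. \<gamma> * vu $ j - vl $ j)"
    by (rule sum_mono)
  then show ?thesis
    using assms by (simp add: phi_eq_sum sum_subtractf sum_distrib_left)
qed

lemma ex1_phi_root: "\<exists>!\<gamma>. \<gamma> \<in> {0<..1} \<and> phi vl vu \<gamma> = 0"
proof -
  define a where "a = (\<Sum>j\<in>UNIV. vl $ j) / (\<Sum>j\<in>UNIV. vu $ j)"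
  have le: "(\<Sum>j\<in>UNIV. vl $ j) \<le> (\<Sum>j\<in>UNIV. vu $ j)"
    using vl_le_vu by (rule sum_mono)
  have a: "0 < a" "a \<le> 1"
    using le sum_vl_pos by (auto simp: a_def)
  have "phi vl vu a \<le> 0"
    using phi_le_linear[OF a(1)] le sum_vl_pos by (simp add: a_def)
  \<comment> \<open>For \<gamma> = 1 the term is \<open>- w 1 j * ln (w 1 j / vu $ j)\<close>, and
    the quotient is at most 1.\<close>
  moreover have "0 \<le> phi_term 1 j" for j
    using start_val_pos[of 1 j] start_val_le[of 1 j] vu_pos[of j]
    by (simp add: phi_term_def mult_nonneg_nonpos)
  then have "0 \<le> phi vl vu 1"
    by (simp add: phi_eq_sum sum_nonneg)
  moreover have "continuous_on {a..1} (phi vl vu)"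
    using a by (intro continuous_on_subset[OF continuous_on_phi]) auto
  ultimately obtain \<gamma> where \<gamma>: "a \<le> \<gamma>" "\<gamma> \<le> 1" "phi vl vu \<gamma> = 0"
    using IVT'[of "phi vl vu" a 0 1] a by auto
  show ?thesis
  proof (rule ex1I[of _ \<gamma>])
    show "\<gamma> \<in> {0<..1} \<and> phi vl vu \<gamma> = 0"
      using \<gamma> a by auto
    fix \<gamma>' assume "\<gamma>' \<in> {0<..1} \<and> phi vl vu \<gamma>' = 0"
    then show "\<gamma>' = \<gamma>"
      using \<gamma> a phi_strict_mono[of \<gamma> \<gamma>'] phi_strict_mono[of \<gamma>' \<gamma>]
      by (cases \<gamma> \<gamma>' rule: linorder_cases) auto
  qed
qed

section \<open>Feasibility and revenue of the optimal mechanism\<close>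

text \<open>A buyer of type \<open>x\<close> is treated as if the type were \<open>max x (w \<gamma> j)\<close>.\<close>

lemma opt_alloc_eq:
  assumes "0 < \<gamma>" "vl $ j \<le> x"
  shows "opt_alloc vu \<gamma> j x = \<gamma> * ln (max x (w \<gamma> j) / vu $ j) + 1"
proof (cases "w \<gamma> j \<le> x")
  case True
  then have "0 < x"
    using start_val_pos[of \<gamma> j] by simp
  moreover have "ln (w \<gamma> j / vu $ j) \<le> ln (x / vu $ j)"
    using True start_val_pos[of \<gamma> j] vu_pos[of j] by (simp add: divide_right_mono)
  then have "\<gamma> * ln (w \<gamma> j / vu $ j) \<le> \<gamma> * ln (x / vu $ j)"
    using assms by simp
  ultimately show ?thesis
    using True start_val_alloc(1)[OF assms(1), of j] by (simp add: opt_alloc_def)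
next
  case False
  then have "w \<gamma> j \<noteq> vl $ j"
    using assms by auto
  then have zero: "\<gamma> * ln (w \<gamma> j / vu $ j) + 1 = 0"
    using assms by (intro start_val_alloc)
  have "\<gamma> * ln (x / vu $ j) + 1 \<le> 0" if "x \<noteq> 0"
  proof -
    have "0 < x"
      using that assms vl_nonneg[of j] by linarith
    then have "ln (x / vu $ j) \<le> ln (w \<gamma> j / vu $ j)"
      using False vu_pos[of j] by (simp add: divide_right_mono)
    then have "\<gamma> * ln (x / vu $ j) \<le> \<gamma> * ln (w \<gamma> j / vu $ j)"
      using assms by simp
    then show ?thesis
      using zero by simp
  qed
  then show ?thesis
    using False zero by (auto simp: opt_alloc_def)
qed

text \<open>The payment is linear in the effective type up to a constant. These constants add up to
  \<open>phi\<close> over the products and therefore cancel at its root.\<close>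

lemma opt_payment_eq:
  assumes "0 < \<gamma>" "vl $ j \<le> x"
  shows "opt_payment vl vu \<gamma> j x = \<gamma> * max x (w \<gamma> j) - phi_term \<gamma> j"
proof (cases "vl $ j < exp (- 1 / \<gamma>) * vu $ j")
  case True
  then have "w \<gamma> j = exp (- 1 / \<gamma>) * vu $ j"
    by (simp add: start_val_eq_max mult.commute)
  moreover from this have "phi_term \<gamma> j = \<gamma> * w \<gamma> j"
    using assms vu_pos[of j] by (simp add: phi_term_def)
  ultimately show ?thesis
    using True by (simp add: opt_payment_def max_def algebra_simps)
next
  case False
  then have "w \<gamma> j = vl $ j"
    by (simp add: start_val_eq_max mult.commute)
  then show ?thesis
    using False assms by (simp add: opt_payment_def phi_term_def algebra_simps)
qed

text \<open>Incentive compatibility for one product, with \<open>y\<close> the effective type of the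
  report. Up to constants the left side is \<open>\<gamma> * (x * ln y - y)\<close>, which increases
  up to \<open>y = x\<close> and decreases afterwards, so on \<open>y \<ge> w \<gamma> j\<close> it
  is largest at \<open>max x (w \<gamma> j)\<close>.\<close>

lemma opt_utility_ge:
  assumes \<gamma>: "0 < \<gamma>" and x: "vl $ j \<le> x" and y: "w \<gamma> j \<le> y"
  shows "(\<gamma> * ln (y / vu $ j) + 1) * x - (\<gamma> * y - phi_term \<gamma> j)
    \<le> opt_alloc vu \<gamma> j x * x - opt_payment vl vu \<gamma> j x"
proof -
  let ?z = "max x (w \<gamma> j)"
  have pos: "0 \<le> x" "0 < ?z" "0 < y"
    using x y vl_nonneg[of j] start_val_pos[of \<gamma> j] by auto
  have "x * (ln (y / vu $ j) - ln (?z / vu $ j)) = x * ln (y / ?z)"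
    using pos vu_pos[of j] by (simp add: ln_div)
  also have "\<dots> \<le> x * (y / ?z - 1)"
    using pos by (intro mult_left_mono ln_le_minus_one) auto
  also have "\<dots> = x / ?z * (y - ?z)"
    using pos by (simp add: field_simps)
  also have "\<dots> \<le> y - ?z"
  proof (cases "w \<gamma> j \<le> x")
    case False
    then have "x / ?z \<le> 1" "0 \<le> y - ?z"
      using pos y by auto
    then show ?thesis
      using mult_right_mono by fastforce
  qed (use pos in auto)
  finally have "\<gamma> * (x * (ln (y / vu $ j) - ln (?z / vu $ j))) \<le> \<gamma> * (y - ?z)"
    using \<gamma> by simp
  then show ?thesis
    unfolding opt_alloc_eq[OF \<gamma> x] opt_payment_eq[OF \<gamma> x] by (simp add: algebra_simps)
qed

text \<open>Reporting the starting value yields \<open>x - w \<gamma> j\<close> times the allocation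
  there, which is nonnegative by \<open>start_val_alloc\<close>. The truth does at least as
  well.\<close>

lemma opt_utility_nonneg:
  assumes \<gamma>: "0 < \<gamma>" and x: "vl $ j \<le> x"
  shows "0 \<le> opt_alloc vu \<gamma> j x * x - opt_payment vl vu \<gamma> j x"
proof -
  have "0 \<le> (x - w \<gamma> j) * (\<gamma> * ln (w \<gamma> j / vu $ j) + 1)"
  proof (cases "w \<gamma> j = vl $ j")
    case True
    then show ?thesis
      using x start_val_alloc(1)[OF \<gamma>, of j] by simp
  qed (simp add: start_val_alloc(2) \<gamma>)
  then have "0 \<le> (\<gamma> * ln (w \<gamma> j / vu $ j) + 1) * x - (\<gamma> * w \<gamma> j - phi_term \<gamma> j)"
    by (simp add: phi_term_def algebra_simps)
  also have "\<dots> \<le> opt_alloc vu \<gamma> j x * x - opt_payment vl vu \<gamma> j x"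
    by (rule opt_utility_ge[OF \<gamma> x order_refl])
  finally show ?thesis .
qed

text \<open>The payment is smallest for types up to the starting value, where it equals the starting
  value times its allocation.\<close>

lemma opt_payment_nonneg:
  assumes \<gamma>: "0 < \<gamma>" and x: "vl $ j \<le> x"
  shows "0 \<le> opt_payment vl vu \<gamma> j x"
proof -
  have "0 \<le> w \<gamma> j * (\<gamma> * ln (w \<gamma> j / vu $ j) + 1)"
    using start_val_pos[of \<gamma> j] start_val_alloc(1)[OF \<gamma>, of j] by simp
  also have "\<dots> = \<gamma> * w \<gamma> j - phi_term \<gamma> j"
    by (simp add: phi_term_def algebra_simps)
  also have "\<dots> \<le> opt_payment vl vu \<gamma> j x"
    unfolding opt_payment_eq[OF assms] using \<gamma> by simp
  finally show ?thesis .
qed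

lemma opt_mech_in_mechanisms:
  assumes \<gamma>: "0 < \<gamma>"
  shows "opt_mech vl vu \<gamma> \<in> mechanisms vl vu"
proof -
  let ?q = "\<lambda>v::real^'n. \<chi> j. opt_alloc vu \<gamma> j (v $ j)"
  let ?t = "\<lambda>v::real^'n. \<Sum>j\<in>UNIV. opt_payment vl vu \<gamma> j (v $ j)"
  have vl: "vl $ j \<le> v $ j" and vu: "v $ j \<le> vu $ j" if "v \<in> cbox vl vu" for v j
    using that by (auto simp: mem_box_cart)
  have utility: "?q v' \<bullet> v - ?t v' =
      (\<Sum>j\<in>UNIV. opt_alloc vu \<gamma> j (v' $ j) * v $ j - opt_payment vl vu \<gamma> j (v' $ j))" for v v'
    by (simp add: inner_vec_def sum_subtractf)
  have "0 \<le> ?q v $ j \<and> ?q v $ j \<le> 1" if v: "v \<in> cbox vl vu" for v j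
  proof
    show "0 \<le> ?q v $ j"
      by (simp add: opt_alloc_def)
    have "0 < max (v $ j) (w \<gamma> j) / vu $ j" "max (v $ j) (w \<gamma> j) / vu $ j \<le> 1"
      using start_val_pos[of \<gamma> j] start_val_le[OF \<gamma>, of j] vu[OF v, of j] vu_pos[of j]
      by (auto simp: less_max_iff_disj)
    then have "ln (max (v $ j) (w \<gamma> j) / vu $ j) \<le> 0"
      by (rule ln_le_zero_iff[THEN iffD2])
    then show "?q v $ j \<le> 1"
      using \<gamma> vl[OF v] by (simp add: opt_alloc_eq mult_nonneg_nonpos)
  qed
  moreover have "0 \<le> ?t v" if "v \<in> cbox vl vu" for v
    using vl[OF that] \<gamma> by (intro sum_nonneg opt_payment_nonneg) auto
  moreover have "?t \<in> borel_measurable (val_space vl vu)"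
    unfolding opt_payment_def by (intro measurable_val_space_borel) measurable
  moreover have "?q v' \<bullet> v - ?t v' \<le> ?q v \<bullet> v - ?t v" if v: "v \<in> cbox vl vu" "v' \<in> cbox vl vu" for v v'
    unfolding utility
  proof (rule sum_mono)
    fix j
    show "opt_alloc vu \<gamma> j (v' $ j) * v $ j - opt_payment vl vu \<gamma> j (v' $ j)
        \<le> opt_alloc vu \<gamma> j (v $ j) * v $ j - opt_payment vl vu \<gamma> j (v $ j)"
      \<comment> \<open>Only the terms of the report \<open>v'\<close> are rewritten; its effective
        type \<open>max (v' $ j) (w \<gamma> j)\<close> plays the part of \<open>y\<close> in
        \<open>opt_utility_ge\<close>.\<close>
      unfolding opt_alloc_eq[OF \<gamma> vl[OF v(2)]] opt_payment_eq[OF \<gamma> vl[OF v(2)]]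
      by (intro opt_utility_ge \<gamma> vl v max.cobounded2)
  qed
  moreover have "0 \<le> ?q v \<bullet> v - ?t v" if "v \<in> cbox vl vu" for v
    unfolding utility using vl[OF that] \<gamma> by (intro sum_nonneg opt_utility_nonneg) auto
  ultimately show ?thesis
    unfolding mechanisms_def opt_mech_def by auto
qed

lemma opt_mech_revenue_ge:
  assumes \<gamma>: "0 < \<gamma>" and root: "phi vl vu \<gamma> = 0" and v: "v \<in> cbox vl vu"
  shows "\<gamma> * (\<Sum>j\<in>UNIV. v $ j) \<le> snd (opt_mech vl vu \<gamma>) v"
proof -
  have "(\<Sum>j\<in>UNIV. \<gamma> * v $ j - phi_term \<gamma> j) \<le> snd (opt_mech vl vu \<gamma>) v"
    unfolding opt_mech_def snd_conv
  proof (rule sum_mono)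
    fix j
    have "vl $ j \<le> v $ j"
      using v by (simp add: mem_box_cart)
    then show "\<gamma> * v $ j - phi_term \<gamma> j \<le> opt_payment vl vu \<gamma> j (v $ j)"
      using \<gamma> by (simp add: opt_payment_eq)
  qed
  then show ?thesis
    using root by (simp add: phi_eq_sum[OF \<gamma>] sum_subtractf sum_distrib_left)
qed

end

section \<open>Integrals with the weight \<open>1 / x\<^sup>2\<close>\<close>

lemma has_bochner_integral_inverse_square_atLeast:
  fixes a :: real
  assumes "0 < a"
  shows "has_bochner_integral lborel (\<lambda>x. indicator {a..} x * (1 / x\<^sup>2)) (1 / a)"
proof (rule has_bochner_integral_nn_integral)
  have "((\<lambda>x::real. - (1 / x)) \<longlongrightarrow> 0) at_top"
    by real_asymp
  then have "(\<integral>\<^sup>+x. ennreal (1 / x\<^sup>2) * indicator {a..} x \<partial>lborel) = ennreal (0 - (- (1 / a)))"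
    using assms
    by (intro nn_integral_FTC_atLeast)
      (auto intro!: derivative_eq_intros simp: power2_eq_square field_simps)
  then show "(\<integral>\<^sup>+x. ennreal (indicator {a..} x * (1 / x\<^sup>2)) \<partial>lborel) = ennreal (1 / a)"
    by (subst (asm) nn_integral_cong[where v = "\<lambda>x. ennreal (indicator {a..} x * (1 / x\<^sup>2))"])
      (auto simp: indicator_def)
qed (use assms in auto)

lemma has_bochner_integral_min_linear:
  fixes a u :: real
  assumes a: "0 < a" and u: "a \<le> u"
  shows "has_bochner_integral lborel (\<lambda>x. indicator {1..} x * (min (a * x) u / x\<^sup>2))
    (a * (1 + ln (u / a)))"
proof -
  \<comment> \<open>The kink of the minimum: the part before it contributes \<open>a * ln X\<close>,
    the part after it contributes \<open>a\<close>.\<close>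
  define X where "X = u / a"
  have X: "1 \<le> X" "u = a * X"
    using a u by (auto simp: X_def)
  have "has_bochner_integral lborel (\<lambda>x. a / x * indicator {1..X} x) (a * ln X - a * ln 1)"
    using a X
    by (intro has_bochner_integral_FTC_Icc_nonneg[where F = "\<lambda>x. a * ln x"])
      (auto intro!: derivative_eq_intros)
  moreover have "has_bochner_integral lborel (\<lambda>x. u * (indicator {X..} x * (1 / x\<^sup>2))) (u * (1 / X))"
    using X by (intro has_bochner_integral_mult_right has_bochner_integral_inverse_square_atLeast) auto
  ultimately have "has_bochner_integral lborel
      (\<lambda>x. a / x * indicator {1..X} x + u * (indicator {X..} x * (1 / x\<^sup>2)))
      (a * ln X - a * ln 1 + u * (1 / X))"
    by (rule has_bochner_integral_add)
  moreover have "a * ln X - a * ln 1 + u * (1 / X) = a * (1 + ln (u / a))"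
    using X a by (simp add: algebra_simps)
  \<comment> \<open>Both indicators are 1 at \<open>X\<close>, so the pieces overlap there, on a
    null set.\<close>
  moreover have "AE x in lborel. a / x * indicator {1..X} x + u * (indicator {X..} x * (1 / x\<^sup>2)) =
      indicator {1..} x * (min (a * x) u / x\<^sup>2)"
    using AE_lborel_singleton[of X]
  proof eventually_elim
    case (elim x)
    then show ?case
      using X a by (auto simp: indicator_def power2_eq_square min_def)
  qed
  ultimately show ?thesis
    by (subst (asm) has_bochner_integral_cong_AE) auto
qed

lemma integrable_bounded_div_square:
  fixes h :: "real \<Rightarrow> real" and a :: real
  assumes "0 < a" "h \<in> borel_measurable borel" "\<And>x. \<bar>h x\<bar> \<le> B"
  shows "integrable lborel (\<lambda>x. indicator {a..} x * (h x / x\<^sup>2))"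
proof (rule Bochner_Integration.integrable_bound)
  show "integrable lborel (\<lambda>x. B * (indicator {a..} x * (1 / x\<^sup>2)))"
    using has_bochner_integral_inverse_square_atLeast[OF assms(1)]
    by (intro integrable_mult_right) (simp add: has_bochner_integral_iff)
  show "(\<lambda>x. indicator {a..} x * (h x / x\<^sup>2)) \<in> borel_measurable lborel"
    using assms(2) by simp
  have "0 \<le> B"
    using assms(3)[of 0] by simp
  then show "AE x in lborel. norm (indicator {a..} x * (h x / x\<^sup>2)) \<le> norm (B * (indicator {a..} x * (1 / x\<^sup>2)))"
    using assms(3) by (auto simp: indicator_def divide_right_mono)
qed

text \<open>Substituting \<open>c * x\<close> scales the weight by \<open>1 / c\<^sup>2\<close> and
  the measure by \<open>c\<close>. In total a factor \<open>c\<close> moves between the two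
  sides.\<close>

lemma integral_div_square_scale:
  fixes h :: "real \<Rightarrow> real" and c :: real
  assumes "0 < c"
  shows "(LBINT x. indicator {1..} x * (h (c * x) / x\<^sup>2)) = c * (LBINT x. indicator {c..} x * (h x / x\<^sup>2))"
proof -
  have "(LBINT x. indicator {c..} x * (h x / x\<^sup>2)) =
      c * (LBINT x. indicator {c..} (0 + c * x) * (h (0 + c * x) / (0 + c * x)\<^sup>2))"
    using assms
    by (subst lborel_integral_real_affine[of c "\<lambda>x. indicator {c..} x * (h x / x\<^sup>2)" 0])
      (auto simp: mult.assoc)
  also have "(\<lambda>x. indicator {c..} (0 + c * x) * (h (0 + c * x) / (0 + c * x)\<^sup>2)) =
      (\<lambda>x. 1 / c\<^sup>2 * (indicator {1..} x * (h (c * x) / x\<^sup>2)))"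
    using assms by (auto simp: indicator_def power_mult_distrib)
  also have "(LBINT x. 1 / c\<^sup>2 * (indicator {1..} x * (h (c * x) / x\<^sup>2))) =
      1 / c\<^sup>2 * (LBINT x. indicator {1..} x * (h (c * x) / x\<^sup>2))"
    by (rule integral_mult_right_zero)
  finally show ?thesis
    using assms by (simp add: power2_eq_square)
qed

section \<open>Incentive compatibility along the curve\<close>

context valuation_bounds
begin

text \<open>The curve is frozen to the left of 1 so that it stays in the box everywhere.\<close>

definition curve :: "real \<Rightarrow> real \<Rightarrow> real^'n" where
  "curve \<gamma> x = val_curve vl vu \<gamma> (max 1 x)"

lemma curve_nth: "curve \<gamma> x $ j = min (w \<gamma> j * max 1 x) (vu $ j)"
  by (simp add: curve_def val_curve_def)

lemma curve_in_box:
  assumes "0 < \<gamma>"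
  shows "curve \<gamma> x \<in> cbox vl vu"
proof -
  have "vl $ j \<le> w \<gamma> j * max 1 x" for j
  proof -
    have "vl $ j \<le> w \<gamma> j * 1"
      using start_val_ge[of j \<gamma>] by simp
    also have "\<dots> \<le> w \<gamma> j * max 1 x"
      using start_val_pos[of \<gamma> j] by (intro mult_left_mono) auto
    finally show ?thesis .
  qed
  then show ?thesis
    using vl_le_vu by (simp add: mem_box_cart curve_nth)
qed

lemma curve_mono: "x \<le> y \<Longrightarrow> curve \<gamma> x $ j \<le> curve \<gamma> y $ j"
  using start_val_pos[of \<gamma> j] unfolding curve_nth
  by (intro min.mono mult_left_mono max.mono) auto

lemma measurable_curve_borel: "curve \<gamma> \<in> borel_measurable borel"
  unfolding curve_def val_curve_def
  by (intro borel_measurable_continuous_onI continuous_intros)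

lemma measurable_curve:
  assumes "0 < \<gamma>"
  shows "curve \<gamma> \<in> measurable borel (val_space vl vu)"
  unfolding val_space_def
  by (rule measurable_restrict_space2) (auto simp: curve_in_box[OF assms] measurable_curve_borel)

text \<open>A coordinate below its cap at \<open>l * x\<close> is linear up to there, and equality
  holds. Once it is capped, the indicator makes the left side nonpositive, while the curve never
  decreases.\<close>

lemma curve_scale_ge:
  assumes l: "1 < l" and x: "1 \<le> x"
  shows "(l - 1) * (curve \<gamma> x $ j - vu $ j * indicator {vu $ j / w \<gamma> j..} (l * x))
    \<le> curve \<gamma> (l * x) $ j - curve \<gamma> x $ j"
proof (cases "vu $ j / w \<gamma> j \<le> l * x")
  case True
  have "1 * x \<le> l * x"
    using l x by (intro mult_right_mono) auto
  then have "0 \<le> curve \<gamma> (l * x) $ j - curve \<gamma> x $ j"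
    using curve_mono[of x "l * x" \<gamma> j] by simp
  moreover have "(l - 1) * (curve \<gamma> x $ j - vu $ j) \<le> 0"
    using l by (intro mult_nonneg_nonpos) (auto simp: curve_nth)
  ultimately show ?thesis
    using True by simp
next
  case False
  then have "w \<gamma> j * (l * x) < vu $ j"
    using start_val_pos[of \<gamma> j] by (simp add: le_divide_eq not_le less_divide_eq mult.commute)
  moreover have "1 * x \<le> l * x"
    using l x by (intro mult_right_mono) auto
  then have "w \<gamma> j * x \<le> w \<gamma> j * (l * x)"
    using start_val_pos[of \<gamma> j] by (intro mult_left_mono) auto
  moreover have "1 \<le> l * x"
    using \<open>1 * x \<le> l * x\<close> x by linarith
  ultimately have "curve \<gamma> (l * x) $ j = w \<gamma> j * (l * x)" "curve \<gamma> x $ j = w \<gamma> j * x"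
    using x by (simp_all add: curve_nth max_def min_def)
  then show ?thesis
    using False by (simp add: algebra_simps)
qed

text \<open>
  Comparing the types \<open>curve \<gamma> x\<close> and \<open>curve \<gamma> (l * x)\<close> by incentive compatibility and integrating
  against \<open>1 / x\<^sup>2\<close> makes the utility terms telescope under the substitution \<open>x \<mapsto> l * x\<close>.
  Letting \<open>l\<close> tend to 1 replaces differentiating the utility along the curve.
\<close>

lemma integral_payment_along_curve_le:
  assumes \<gamma>: "0 < \<gamma>" and M: "M \<in> mechanisms vl vu"
  shows "(LBINT x. indicator {1..} x * (snd M (curve \<gamma> x) / x\<^sup>2)) \<le> (\<Sum>j\<in>UNIV. w \<gamma> j)"
proof -
  define T where "T x = snd M (curve \<gamma> x)" for x
  define U where "U x = fst M (curve \<gamma> x) \<bullet> curve \<gamma> x - T x" for x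
  \<comment> \<open>\<open>C x\<close> adds up the caps of the products that have reached them by
    \<open>x\<close>, that is, the part of the total value that no longer grows along the
    curve.\<close>
  define C where "C x = (\<Sum>j\<in>UNIV. vu $ j * indicator {vu $ j / w \<gamma> j..} x)" for x :: real
  define I where "I a h = (LBINT x. indicator {a..} x * (h x / x\<^sup>2))" for a :: real and h :: "real \<Rightarrow> real"
  let ?V = "\<Sum>j\<in>UNIV. vu $ j"
  note mech = mechanismD[OF M curve_in_box[OF \<gamma>]]

  have IC: "fst M (curve \<gamma> x) \<bullet> (curve \<gamma> y - curve \<gamma> x) \<le> U y - U x" for x y
    using mech(6)[OF curve_in_box[OF \<gamma>, of x], of y] by (simp add: U_def T_def inner_diff_right)
  have U_mono: "U x \<le> U y" if "x \<le> y" for x y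
  proof -
    have "0 \<le> fst M (curve \<gamma> x) \<bullet> (curve \<gamma> y - curve \<gamma> x)"
      unfolding inner_vec_def using mech(1) curve_mono[OF that] by (auto intro!: sum_nonneg)
    then show ?thesis
      using IC[of x y] by simp
  qed
  have V: "(\<Sum>j\<in>UNIV. curve \<gamma> x $ j) \<le> ?V" for x
    by (intro sum_mono) (simp add: curve_nth)
  have T: "0 \<le> T x" "T x \<le> ?V" for x
    unfolding T_def using mech(3,5) V by (auto intro: order_trans)
  have U_nonneg: "0 \<le> U x" for x
    using mech(4)[of x] by (simp add: U_def T_def)
  have U_le: "U x \<le> ?V" for x
  proof -
    have "fst M (curve \<gamma> x) \<bullet> curve \<gamma> x \<le> (\<Sum>j\<in>UNIV. curve \<gamma> x $ j)"
      unfolding inner_vec_def inner_real_def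
    proof (rule sum_mono)
      fix j
      have "0 \<le> curve \<gamma> x $ j"
        using curve_in_box[OF \<gamma>, of x] vl_nonneg[of j] by (auto simp: mem_box_cart intro: order_trans)
      then show "fst M (curve \<gamma> x) $ j * curve \<gamma> x $ j \<le> curve \<gamma> x $ j"
        using mech(2)[of x j] mult_right_mono by fastforce
    qed
    then show ?thesis
      using V[of x] T(1)[of x] by (simp add: U_def)
  qed
  have C: "0 \<le> C x" "C x \<le> ?V" for x
    unfolding C_def using vu_pos
    by (intro sum_nonneg sum_mono; simp add: indicator_def less_imp_le)+
  have meas: "T \<in> borel_measurable borel" "U \<in> borel_measurable borel" "C \<in> borel_measurable borel"
  proof -
    show "T \<in> borel_measurable borel"
      unfolding T_def using measurable_compose[OF measurable_curve[OF \<gamma>] measurable_payment[OF M]] .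
    \<comment> \<open>Measurability of the allocation is not among the constraints on a mechanism,
      so \<open>U\<close> obtains it from monotonicity.\<close>
    show "U \<in> borel_measurable borel"
      using U_mono by (intro borel_measurable_mono monoI)
    show "C \<in> borel_measurable borel"
      unfolding C_def by measurable
  qed
  have integrable: "integrable lborel (\<lambda>x. indicator {a..} x * (h (l * x) / x\<^sup>2))"
    if "0 < a" "h \<in> {T, U, C}" for a h and l :: real
    using that T U_nonneg U_le C meas
    by (intro integrable_bounded_div_square[where B = ?V]) (auto simp: abs_of_nonneg)
  note integrable1 = integrable[where l = 1, simplified]
  have I_mono: "I l h \<le> I 1 h" if "1 < l" "h \<in> {U, C}" for l h
    unfolding I_def
    using that integrable1[of l h] integrable1[of 1 h] U_nonneg C(1)
    by (intro integral_mono) (auto simp: indicator_def)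
  \<comment> \<open>Each cap \<open>vu $ j\<close> is integrated from
    \<open>vu $ j / w \<gamma> j\<close> onwards, which leaves exactly the starting value.\<close>
  have I_C: "I 1 C = (\<Sum>j\<in>UNIV. w \<gamma> j)"
  proof -
    have "has_bochner_integral lborel (\<lambda>x. vu $ j * (indicator {vu $ j / w \<gamma> j..} x * (1 / x\<^sup>2)))
        (vu $ j * (1 / (vu $ j / w \<gamma> j)))" for j
      using vu_pos start_val_pos
      by (intro has_bochner_integral_mult_right has_bochner_integral_inverse_square_atLeast) simp
    then have "has_bochner_integral lborel
        (\<lambda>x. \<Sum>j\<in>UNIV. vu $ j * (indicator {vu $ j / w \<gamma> j..} x * (1 / x\<^sup>2)))
        (\<Sum>j\<in>UNIV. vu $ j * (1 / (vu $ j / w \<gamma> j)))"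
      by (intro has_bochner_integral_sum)
    moreover have "vu $ j * (1 / (vu $ j / w \<gamma> j)) = w \<gamma> j" for j
      using vu_pos[of j] by simp
    moreover have "(\<Sum>j\<in>UNIV. vu $ j * (indicator {vu $ j / w \<gamma> j..} x * (1 / x\<^sup>2))) =
        indicator {1..} x * (C x / x\<^sup>2)" for x
    proof -
      have "1 \<le> vu $ j / w \<gamma> j" for j
        using start_val_pos[of \<gamma> j] start_val_le[OF \<gamma>, of j] by simp
      then have "indicator {vu $ j / w \<gamma> j..} x =
          (indicator {1..} x * indicator {vu $ j / w \<gamma> j..} x :: real)" for j
        by (auto simp: indicator_def intro: order_trans)
      then show ?thesis
        unfolding C_def sum_divide_distrib sum_distrib_left
        by (intro sum.cong refl) (auto simp: indicator_def)
    qed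
    ultimately show ?thesis
      unfolding I_def by (simp add: has_bochner_integral_integral_eq)
  qed
  have bound: "I 1 T \<le> l * (\<Sum>j\<in>UNIV. w \<gamma> j)" if l: "1 < l" for l
  proof -
    \<comment> \<open>\<open>curve_scale_ge\<close> is weighted with the allocation at
      \<open>curve \<gamma> x\<close>, whose entries are at most 1, and combined with
      \<open>IC\<close>. Writing the gross value as \<open>U x + T x\<close> and solving for
      \<open>T x\<close> produces the coefficient \<open>l\<close> of \<open>U x\<close>.\<close>
    have point: "(l - 1) * T x \<le> U (l * x) - l * U x + (l - 1) * C (l * x)" if x: "1 \<le> x" for x
    proof -
      let ?q = "fst M (curve \<gamma> x)" and ?ind = "\<lambda>j. indicator {vu $ j / w \<gamma> j..} (l * x) :: real"
      have "(l - 1) * (?q \<bullet> curve \<gamma> x - C (l * x)) \<le>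
          (\<Sum>j\<in>UNIV. ?q $ j * ((l - 1) * (curve \<gamma> x $ j - vu $ j * ?ind j)))"
        unfolding inner_vec_def inner_real_def C_def sum_subtractf[symmetric] sum_distrib_left
      proof (rule sum_mono)
        fix j
        have "?q $ j * (vu $ j * ?ind j) \<le> 1 * (vu $ j * ?ind j)"
          using mech(2) vu_pos[of j] by (intro mult_right_mono) auto
        then have "(l - 1) * (?q $ j * curve \<gamma> x $ j - vu $ j * ?ind j)
            \<le> (l - 1) * (?q $ j * curve \<gamma> x $ j - ?q $ j * (vu $ j * ?ind j))"
          using l by (intro mult_left_mono) auto
        then show "(l - 1) * (?q $ j * curve \<gamma> x $ j - vu $ j * ?ind j)
            \<le> ?q $ j * ((l - 1) * (curve \<gamma> x $ j - vu $ j * ?ind j))"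
          by (simp add: algebra_simps)
      qed
      also have "\<dots> \<le> ?q \<bullet> (curve \<gamma> (l * x) - curve \<gamma> x)"
        unfolding inner_vec_def inner_real_def vector_minus_component
        by (intro sum_mono mult_left_mono curve_scale_ge l x mech(1))
      also have "\<dots> \<le> U (l * x) - U x"
        by (rule IC)
      finally show ?thesis
        by (simp add: U_def algebra_simps)
    qed
    let ?i = "\<lambda>h x. indicator {1..} x * (h x / x\<^sup>2) :: real"
    have rhs: "has_bochner_integral lborel
        (\<lambda>x. ?i (\<lambda>x. U (l * x)) x - l * ?i U x + (l - 1) * ?i (\<lambda>x. C (l * x)) x)
        (I 1 (\<lambda>x. U (l * x)) - l * I 1 U + (l - 1) * I 1 (\<lambda>x. C (l * x)))"
      unfolding I_def
      using integrable[of 1 U l] integrable1[of 1 U] integrable[of 1 C l]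
      by (intro has_bochner_integral_add has_bochner_integral_diff has_bochner_integral_mult_right
          has_bochner_integral_integrable) simp_all
    have "(l - 1) * I 1 T = (LBINT x. (l - 1) * ?i T x)"
      unfolding I_def by (rule integral_mult_right_zero[symmetric])
    also have "\<dots> \<le> (LBINT x. ?i (\<lambda>x. U (l * x)) x - l * ?i U x + (l - 1) * ?i (\<lambda>x. C (l * x)) x)"
    proof (rule integral_mono)
      show "integrable lborel (\<lambda>x. (l - 1) * ?i T x)"
        using integrable1[of 1 T] by (intro integrable_mult_right) simp
      show "integrable lborel
          (\<lambda>x. ?i (\<lambda>x. U (l * x)) x - l * ?i U x + (l - 1) * ?i (\<lambda>x. C (l * x)) x)"
        using rhs by (rule integrable.intros)
      fix x :: real
      show "(l - 1) * ?i T x \<le> ?i (\<lambda>x. U (l * x)) x - l * ?i U x + (l - 1) * ?i (\<lambda>x. C (l * x)) x"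
      proof (cases "1 \<le> x")
        case True
        then have "(l - 1) * T x / x\<^sup>2 \<le> (U (l * x) - l * U x + (l - 1) * C (l * x)) / x\<^sup>2"
          using point by (intro divide_right_mono) auto
        then show ?thesis
          using True by (simp add: add_divide_distrib diff_divide_distrib)
      qed simp
    qed
    also have "\<dots> = I 1 (\<lambda>x. U (l * x)) - l * I 1 U + (l - 1) * I 1 (\<lambda>x. C (l * x))"
      using rhs by (rule has_bochner_integral_integral_eq)
    \<comment> \<open>After the substitution both utility terms carry the factor \<open>l\<close>
      and differ only in their domains. Since \<open>U\<close> and \<open>C\<close> are nonnegative,
      starting at \<open>l\<close> instead of 1 can only lower the integral.\<close>
    also have "\<dots> = l * I l U - l * I 1 U + (l - 1) * (l * I l C)"
      unfolding I_def using l by (simp only: integral_div_square_scale)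
    also have "\<dots> \<le> (l - 1) * (l * I 1 C)"
    proof -
      have "l * I l U \<le> l * I 1 U" "(l - 1) * (l * I l C) \<le> (l - 1) * (l * I 1 C)"
        using l I_mono by auto
      then show ?thesis
        by simp
    qed
    finally show ?thesis
      using l by (simp add: I_C)
  qed
  have "I 1 T \<le> (\<Sum>j\<in>UNIV. w \<gamma> j)"
  proof (rule tendsto_lowerbound)
    show "((\<lambda>l. l * (\<Sum>j\<in>UNIV. w \<gamma> j)) \<longlongrightarrow> (\<Sum>j\<in>UNIV. w \<gamma> j)) (at_right 1)"
      by (auto intro!: tendsto_eq_intros)
    show "\<forall>\<^sub>F l in at_right 1. I 1 T \<le> l * (\<Sum>j\<in>UNIV. w \<gamma> j)"
      using bound by (auto simp: eventually_at_right_field intro: exI[of _ 2])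
  qed simp
  then show ?thesis
    by (simp add: I_def T_def)
qed

section \<open>The law of \<xi> and the worst distribution\<close>

text \<open>The integral of the total value along the curve against \<open>1 / x\<^sup>2\<close> in
  closed form, hence the reciprocal of \<open>norm_const\<close>.\<close>

definition curve_mass :: "real \<Rightarrow> real" where
  "curve_mass \<gamma> = (\<Sum>j\<in>UNIV. w \<gamma> j * (1 + ln (vu $ j / w \<gamma> j)))"

lemma curve_mass_pos:
  assumes "0 < \<gamma>"
  shows "0 < curve_mass \<gamma>"
  unfolding curve_mass_def
proof (rule sum_pos)
  fix j
  have "0 \<le> ln (vu $ j / w \<gamma> j)"
    using start_val_pos[of \<gamma> j] start_val_le[OF assms, of j] by (intro ln_ge_zero) simp
  then show "0 < w \<gamma> j * (1 + ln (vu $ j / w \<gamma> j))"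
    using start_val_pos[of \<gamma> j] by simp
qed auto

text \<open>For positive \<gamma>, \<open>phi\<close> is the difference of the two sides, because
  \<open>ln (w \<gamma> j / vu $ j)\<close> is the negative of the logarithm in
  \<open>curve_mass\<close>.\<close>

lemma curve_mass_root:
  assumes "0 < \<gamma>" "phi vl vu \<gamma> = 0"
  shows "\<gamma> * curve_mass \<gamma> = (\<Sum>j\<in>UNIV. w \<gamma> j)"
proof -
  have "phi_term \<gamma> j = \<gamma> * (w \<gamma> j * (1 + ln (vu $ j / w \<gamma> j))) - w \<gamma> j" for j
    using start_val_pos[of \<gamma> j] vu_pos[of j] by (simp add: phi_term_def ln_div algebra_simps)
  then have "(\<Sum>j\<in>UNIV. phi_term \<gamma> j) = \<gamma> * curve_mass \<gamma> - (\<Sum>j\<in>UNIV. w \<gamma> j)"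
    by (simp add: sum_subtractf sum_distrib_left curve_mass_def)
  then show ?thesis
    using assms by (simp add: phi_eq_sum)
qed

definition xi_density :: "real \<Rightarrow> real \<Rightarrow> real" where
  "xi_density \<gamma> x = indicator {1..} x * ((\<Sum>j\<in>UNIV. curve \<gamma> x $ j) / x\<^sup>2) / curve_mass \<gamma>"

lemma has_bochner_integral_curve:
  assumes "0 < \<gamma>"
  shows "has_bochner_integral lborel
    (\<lambda>x. indicator {1..} x * ((\<Sum>j\<in>UNIV. curve \<gamma> x $ j) / x\<^sup>2)) (curve_mass \<gamma>)"
proof -
  have "has_bochner_integral lborel
      (\<lambda>x. \<Sum>j\<in>UNIV. indicator {1..} x * (min (w \<gamma> j * x) (vu $ j) / x\<^sup>2)) (curve_mass \<gamma>)"
    unfolding curve_mass_def using start_val_pos start_val_le[OF assms]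
    by (intro has_bochner_integral_sum has_bochner_integral_min_linear)
  moreover have "(\<Sum>j\<in>UNIV. indicator {1..} x * (min (w \<gamma> j * x) (vu $ j) / x\<^sup>2)) =
      indicator {1..} x * ((\<Sum>j\<in>UNIV. curve \<gamma> x $ j) / x\<^sup>2)" for x
    by (cases "1 \<le> x") (auto simp: curve_nth sum_divide_distrib)
  ultimately show ?thesis
    by simp
qed

lemma xi_density_nonneg: "0 < \<gamma> \<Longrightarrow> 0 \<le> xi_density \<gamma> x"
  unfolding xi_density_def using sum_valuation_pos[OF curve_in_box, of \<gamma> x] curve_mass_pos[of \<gamma>]
  by (auto simp: indicator_def)

lemma has_bochner_integral_xi_density:
  assumes "0 < \<gamma>"
  shows "has_bochner_integral lborel (xi_density \<gamma>) 1"
proof -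
  have "has_bochner_integral lborel
      (\<lambda>x. indicator {1..} x * ((\<Sum>j\<in>UNIV. curve \<gamma> x $ j) / x\<^sup>2) / curve_mass \<gamma>)
      (curve_mass \<gamma> / curve_mass \<gamma>)"
    by (intro has_bochner_integral_divide_zero has_bochner_integral_curve assms)
  then show ?thesis
    using curve_mass_pos[OF assms] unfolding xi_density_def by simp
qed

lemma measurable_xi_density: "xi_density \<gamma> \<in> borel_measurable borel"
proof -
  have "(\<lambda>x. curve \<gamma> x $ j) \<in> borel_measurable borel" for j
    unfolding curve_nth by measurable
  then show ?thesis
    unfolding xi_density_def by measurable
qed

lemma norm_const_eq:
  assumes "0 < \<gamma>"
  shows "norm_const vl vu \<gamma> = inverse (curve_mass \<gamma>)"
proof -
  have "(LBINT x:{1..}. (\<Sum>j\<in>UNIV. val_curve vl vu \<gamma> x $ j) / x\<^sup>2) =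
      (LBINT x. indicator {1..} x * ((\<Sum>j\<in>UNIV. curve \<gamma> x $ j) / x\<^sup>2))"
    unfolding set_lebesgue_integral_def
    by (intro Bochner_Integration.integral_cong) (auto simp: indicator_def curve_def)
  also have "\<dots> = curve_mass \<gamma>"
    using has_bochner_integral_curve[OF assms] by (rule has_bochner_integral_integral_eq)
  finally show ?thesis
    by (simp add: norm_const_def)
qed

definition xi_measure :: "real \<Rightarrow> real measure" where
  "xi_measure \<gamma> = density lborel (\<lambda>x. ennreal (xi_density \<gamma> x))"

lemma integral_xi_measure:
  fixes f :: "real \<Rightarrow> real"
  assumes "0 < \<gamma>" "f \<in> borel_measurable borel"
  shows "(\<integral>x. f x \<partial>xi_measure \<gamma>) = (LBINT x. xi_density \<gamma> x * f x)"
  unfolding xi_measure_def using assms measurable_xi_density xi_density_nonneg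
  by (subst integral_density) auto

lemma real_distribution_xi_measure:
  assumes "0 < \<gamma>"
  shows "real_distribution (xi_measure \<gamma>)"
proof -
  have "emeasure (xi_measure \<gamma>) (space (xi_measure \<gamma>)) = (\<integral>\<^sup>+x. ennreal (xi_density \<gamma> x) \<partial>lborel)"
    using measurable_xi_density by (simp add: xi_measure_def emeasure_density)
  also have "\<dots> = ennreal 1"
    using has_bochner_integral_xi_density[OF assms] xi_density_nonneg[OF assms]
    by (simp add: nn_integral_eq_integral has_bochner_integral_iff)
  finally interpret prob_space "xi_measure \<gamma>"
    by (intro prob_spaceI) simp
  show ?thesis
    by unfold_locales (simp_all add: xi_measure_def)
qed

lemma cdf_xi_measure:
  assumes "0 < \<gamma>"
  shows "cdf (xi_measure \<gamma>) = xi_cdf vl vu \<gamma>"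
proof
  fix y
  interpret real_distribution "xi_measure \<gamma>"
    using assms by (rule real_distribution_xi_measure)
  have "cdf (xi_measure \<gamma>) y = (\<integral>x. indicator {..y} x \<partial>xi_measure \<gamma>)"
    by (simp add: cdf_def)
  also have "\<dots> = (LBINT x. xi_density \<gamma> x * indicator {..y} x)"
    using assms by (intro integral_xi_measure) auto
  also have "\<dots> = (LBINT x. norm_const vl vu \<gamma> *
      (indicator {1..y} x *\<^sub>R ((\<Sum>j\<in>UNIV. val_curve vl vu \<gamma> x $ j) / x\<^sup>2)))"
    using norm_const_eq[OF assms]
    by (intro Bochner_Integration.integral_cong)
      (auto simp: indicator_def xi_density_def curve_def inverse_eq_divide)
  also have "\<dots> = xi_cdf vl vu \<gamma> y"
    unfolding xi_cdf_def set_lebesgue_integral_def by (rule integral_mult_right_zero)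
  finally show "cdf (xi_measure \<gamma>) y = xi_cdf vl vu \<gamma> y" .
qed

text \<open>A distribution on the line is determined by its cdf. Identifying the Stieltjes measure
  with one given by a density turns integrals under the law of \<xi> into Lebesgue
  integrals.\<close>

lemma interval_measure_xi_cdf:
  assumes "0 < \<gamma>"
  shows "interval_measure (xi_cdf vl vu \<gamma>) = xi_measure \<gamma>"
proof -
  interpret real_distribution "xi_measure \<gamma>"
    using assms by (rule real_distribution_xi_measure)
  note F = cdf_nondecreasing cdf_is_right_cont cdf_lim_at_bot cdf_lim_at_top_prob
  have "real_distribution (interval_measure (cdf (xi_measure \<gamma>)))"
    by (intro real_distribution_interval_measure F)
  moreover have "cdf (interval_measure (cdf (xi_measure \<gamma>))) = cdf (xi_measure \<gamma>)"
    by (intro cdf_interval_measure F)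
  ultimately have "interval_measure (cdf (xi_measure \<gamma>)) = xi_measure \<gamma>"
    by (intro cdf_unique real_distribution_axioms)
  then show ?thesis
    by (simp add: cdf_xi_measure assms)
qed

lemma xi_law_eq: "0 < \<gamma> \<Longrightarrow> xi_law vl vu \<gamma> = restrict_space (xi_measure \<gamma>) {1..}"
  by (simp add: xi_law_def interval_measure_xi_cdf)

lemma measurable_val_curve:
  assumes "0 < \<gamma>"
  shows "val_curve vl vu \<gamma> \<in> measurable (xi_law vl vu \<gamma>) (val_space vl vu)"
proof -
  have "curve \<gamma> \<in> measurable (xi_law vl vu \<gamma>) (val_space vl vu)"
    unfolding xi_law_eq[OF assms] using measurable_curve[OF assms]
    by (intro measurable_restrict_space1) (simp add: xi_measure_def)
  then show ?thesis
    by (subst measurable_cong[where g = "curve \<gamma>"])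
      (auto simp: xi_law_eq assms space_restrict_space curve_def max_def)
qed

lemma worst_dist_in_distributions:
  assumes "0 < \<gamma>"
  shows "worst_dist vl vu \<gamma> \<in> distributions vl vu"
proof -
  interpret real_distribution "xi_measure \<gamma>"
    using assms by (rule real_distribution_xi_measure)
  \<comment> \<open>The density vanishes to the left of 1, so restricting the law to
    \<open>{1..}\<close> loses no mass.\<close>
  have "prob {1..} = (\<integral>x. indicator {1..} x \<partial>xi_measure \<gamma>)"
    by simp
  also have "\<dots> = (LBINT x. xi_density \<gamma> x * indicator {1..} x)"
    using assms by (intro integral_xi_measure) auto
  also have "\<dots> = (LBINT x. xi_density \<gamma> x)"
    by (intro Bochner_Integration.integral_cong) (auto simp: xi_density_def indicator_def)
  also have "\<dots> = 1"
    using has_bochner_integral_xi_density[OF assms] by (rule has_bochner_integral_integral_eq)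
  finally have "prob_space (xi_law vl vu \<gamma>)"
    unfolding xi_law_eq[OF assms]
    by (intro prob_space_restrict_space) (auto simp: emeasure_eq_measure)
  then have "prob_space (worst_dist vl vu \<gamma>)"
    unfolding worst_dist_def
    by (rule prob_space.prob_space_distr) (rule measurable_val_curve[OF assms])
  then show ?thesis
    by (simp add: distributions_def worst_dist_def)
qed

lemma integral_worst_dist:
  fixes g :: "real^'n \<Rightarrow> real"
  assumes \<gamma>: "0 < \<gamma>" and g: "g \<in> borel_measurable (val_space vl vu)"
  shows "(\<integral>v. g v \<partial>worst_dist vl vu \<gamma>) = (LBINT x. xi_density \<gamma> x * g (curve \<gamma> x))"
proof -
  have meas: "(\<lambda>x. g (curve \<gamma> x)) \<in> borel_measurable borel"
    using measurable_compose[OF measurable_curve[OF \<gamma>] g] .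
  have "(\<integral>v. g v \<partial>worst_dist vl vu \<gamma>) = (\<integral>x. g (val_curve vl vu \<gamma> x) \<partial>xi_law vl vu \<gamma>)"
    unfolding worst_dist_def by (rule integral_distr[OF measurable_val_curve[OF \<gamma>] g])
  also have "\<dots> = (\<integral>x. indicator {1..} x *\<^sub>R g (val_curve vl vu \<gamma> x) \<partial>xi_measure \<gamma>)"
    unfolding xi_law_eq[OF \<gamma>] by (rule integral_restrict_space) (simp add: xi_measure_def)
  also have "\<dots> = (\<integral>x. indicator {1..} x * g (curve \<gamma> x) \<partial>xi_measure \<gamma>)"
    by (intro Bochner_Integration.integral_cong) (auto simp: indicator_def curve_def)
  also have "\<dots> = (LBINT x. xi_density \<gamma> x * (indicator {1..} x * g (curve \<gamma> x)))"
    using meas by (intro integral_xi_measure \<gamma>) auto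
  also have "\<dots> = (LBINT x. xi_density \<gamma> x * g (curve \<gamma> x))"
    by (intro Bochner_Integration.integral_cong) (auto simp: xi_density_def indicator_def)
  finally show ?thesis .
qed

section \<open>Saddle point and performance ratio\<close>

lemma rel_Rev_worst_dist_le:
  assumes \<gamma>: "0 < \<gamma>" and root: "phi vl vu \<gamma> = 0" and M: "M \<in> mechanisms vl vu"
  shows "rel_Rev M (worst_dist vl vu \<gamma>) \<le> \<gamma>"
proof -
  have "(\<lambda>v. snd M v / (\<Sum>j\<in>UNIV. v $ j)) \<in> borel_measurable (val_space vl vu)"
    by (intro borel_measurable_divide measurable_payment[OF M] measurable_val_space_borel) measurable
  then have "rel_Rev M (worst_dist vl vu \<gamma>) =
      (LBINT x. xi_density \<gamma> x * (snd M (curve \<gamma> x) / (\<Sum>j\<in>UNIV. curve \<gamma> x $ j)))"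
    unfolding rel_Rev_def by (rule integral_worst_dist[OF \<gamma>])
  \<comment> \<open>The density contains the total value as a factor, which cancels the denominator
    of the relative revenue.\<close>
  also have "\<dots> = (LBINT x. indicator {1..} x * (snd M (curve \<gamma> x) / x\<^sup>2) / curve_mass \<gamma>)"
    using sum_valuation_pos[OF curve_in_box[OF \<gamma>]]
    by (intro Bochner_Integration.integral_cong) (auto simp: xi_density_def less_le)
  also have "\<dots> = (LBINT x. indicator {1..} x * (snd M (curve \<gamma> x) / x\<^sup>2)) / curve_mass \<gamma>"
    by (rule integral_divide_zero)
  also have "\<dots> \<le> (\<Sum>j\<in>UNIV. w \<gamma> j) / curve_mass \<gamma>"
    using curve_mass_pos[OF \<gamma>] by (intro divide_right_mono integral_payment_along_curve_le \<gamma> M) auto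
  also have "\<dots> = \<gamma>"
    using curve_mass_pos[OF \<gamma>] by (simp add: curve_mass_root[OF \<gamma> root, symmetric])
  finally show ?thesis .
qed

lemma saddle_point_opt_mech:
  assumes \<gamma>: "0 < \<gamma>" and root: "phi vl vu \<gamma> = 0"
  shows "saddle_point (mechanisms vl vu) (distributions vl vu) rel_Rev
    (opt_mech vl vu \<gamma>) (worst_dist vl vu \<gamma>)"
proof -
  note opt = opt_mech_in_mechanisms[OF \<gamma>] and worst = worst_dist_in_distributions[OF \<gamma>]
  have ge: "\<gamma> \<le> rel_Rev (opt_mech vl vu \<gamma>) F" if "F \<in> distributions vl vu" for F
    by (rule rel_Rev_ge[OF opt that opt_mech_revenue_ge[OF \<gamma> root]])
  then have "rel_Rev (opt_mech vl vu \<gamma>) (worst_dist vl vu \<gamma>) = \<gamma>"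
    using worst rel_Rev_worst_dist_le[OF \<gamma> root opt] by (intro antisym) auto
  then show ?thesis
    using opt worst ge rel_Rev_worst_dist_le[OF \<gamma> root] by (auto simp: saddle_point_def)
qed

lemma performance_ratio_opt_mech:
  assumes \<gamma>: "0 < \<gamma>" and root: "phi vl vu \<gamma> = 0"
  shows "performance_ratio vl vu (opt_mech vl vu \<gamma>) = ereal \<gamma>"
    "(SUP M \<in> mechanisms vl vu. performance_ratio vl vu M) = ereal \<gamma>"
proof -
  note opt = opt_mech_in_mechanisms[OF \<gamma>]
  have upper: "performance_ratio vl vu M \<le> ereal \<gamma>" if "M \<in> mechanisms vl vu" for M
  proof -
    have "performance_ratio vl vu M \<le> ereal (rel_Rev M (worst_dist vl vu \<gamma>))"
      by (rule performance_ratio_le_rel_Rev[OF that worst_dist_in_distributions[OF \<gamma>]])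
    also have "\<dots> \<le> ereal \<gamma>"
      using rel_Rev_worst_dist_le[OF \<gamma> root that] by simp
    finally show ?thesis .
  qed
  show eq: "performance_ratio vl vu (opt_mech vl vu \<gamma>) = ereal \<gamma>"
    by (intro antisym upper[OF opt] performance_ratio_ge[OF opt \<gamma> opt_mech_revenue_ge[OF \<gamma> root]])
  show "(SUP M \<in> mechanisms vl vu. performance_ratio vl vu M) = ereal \<gamma>"
  proof (intro antisym SUP_least upper)
    show "ereal \<gamma> \<le> (SUP M \<in> mechanisms vl vu. performance_ratio vl vu M)"
      unfolding eq[symmetric] by (rule SUP_upper[OF opt])
  qed
qed

end

theorem theorem1:
  fixes vl vu :: "real^'n"
  assumes "\<And>j. 0 \<le> vl $ j"
    and "\<And>j. vl $ j \<le> vu $ j"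
    and "\<And>j. 0 < vu $ j"
    and "Max (range (\<lambda>j. vl $ j)) > 0"
  shows "(\<exists>!\<gamma>. \<gamma> \<in> {0<..1} \<and> phi vl vu \<gamma> = 0) \<and>
    (\<forall>\<gamma>. \<gamma> \<in> {0<..1} \<and> phi vl vu \<gamma> = 0 \<longrightarrow>
       saddle_point (mechanisms vl vu) (distributions vl vu) rel_Rev
         (opt_mech vl vu \<gamma>) (worst_dist vl vu \<gamma>) \<and>
       opt_mech vl vu \<gamma> \<in> mechanisms vl vu \<and>
       performance_ratio vl vu (opt_mech vl vu \<gamma>)
         = (SUP M \<in> mechanisms vl vu. performance_ratio vl vu M) \<and>
       (SUP M \<in> mechanisms vl vu. performance_ratio vl vu M) = ereal \<gamma>)"
proof -
  interpret valuation_bounds vl vu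
    using assms by unfold_locales
  show ?thesis
  proof (intro conjI allI impI)
    show "\<exists>!\<gamma>. \<gamma> \<in> {0<..1} \<and> phi vl vu \<gamma> = 0"
      by (rule ex1_phi_root)
  next
    fix \<gamma> assume "\<gamma> \<in> {0<..1} \<and> phi vl vu \<gamma> = 0"
    then have \<gamma>: "0 < \<gamma>" and root: "phi vl vu \<gamma> = 0"
      by auto
    show "saddle_point (mechanisms vl vu) (distributions vl vu) rel_Rev
        (opt_mech vl vu \<gamma>) (worst_dist vl vu \<gamma>)"
      by (rule saddle_point_opt_mech[OF \<gamma> root])
    show "opt_mech vl vu \<gamma> \<in> mechanisms vl vu"
      by (rule opt_mech_in_mechanisms[OF \<gamma>])
    show "(SUP M \<in> mechanisms vl vu. performance_ratio vl vu M) = ereal \<gamma>"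
      by (rule performance_ratio_opt_mech[OF \<gamma> root])
    then show "performance_ratio vl vu (opt_mech vl vu \<gamma>)
        = (SUP M \<in> mechanisms vl vu. performance_ratio vl vu M)"
      using performance_ratio_opt_mech(1)[OF \<gamma> root] by simp
  qed
qed

end
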